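(* On the set of grid functions $w$ vanishing on $\partial\omega$, let the one-dimensional operators $A_1,A_2$ be defined for $\boldsymbol x\in\omega$ either by (case a) $$\begin{aligned}A_1w=&-\tfrac1{h_1^2}k(x_1+0.5h_1,x_2)e^{\theta_1(\boldsymbol x,t)h_1}\big(w(x_1+h_1,x_2)-w(\boldsymbol x)\big)+\tfrac1{h_1^2}k(x_1-0.5h_1,x_2)e^{-\theta_1(\boldsymbol x,t)h_1}\big(w(\boldsymbol x)-w(x_1-h_1,x_2)\big),\\ A_2w=&-\tfrac1{h_2^2}k(x_1,x_2+0.5h_2)e^{\theta_2(\boldsymbol x,t)h_2}\big(w(x_1,x_2+h_2)-w(\boldsymbol x)\big)+\tfrac1{h_2^2}k(x_1,x_2-0.5h_2)e^{-\theta_2(\boldsymbol x,t)h_2}\big(w(\boldsymbol x)-w(x_1,x_2-h_2)\big),\end{aligned}$$ or by (case b) $$\begin{aligned}A_1w=&-\tfrac1{h_1^2}k(x_1+0.5h_1,x_2)e^{-\theta_1(x_1+h_1,x_2,t)h_1}w(x_1+h_1,x_2)+\tfrac1{h_1^2}k(x_1+0.5h_1,x_2)e^{\theta_1(\boldsymbol x,t)h_1}w(\boldsymbol x)\\&+\tfrac1{h_1^2}k(x_1-0.5h_1,x_2)e^{-\theta_1(\boldsymbol x,t)h_1}w(\boldsymbol x)-\tfrac1{h_1^2}k(x_1-0.5h_1,x_2)e^{\theta_1(x_1-h_1,x_2,t)h_1}w(x_1-h_1,x_2),\\ A_2w=&-\tfrac1{h_2^2}k(x_1,x_2+0.5h_2)e^{-\theta_2(x_1,x_2+h_2,t)h_2}w(x_1,x_2+h_2)+\tfrac1{h_2^2}k(x_1,x_2+0.5h_2)e^{\theta_2(\boldsymbol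 x,t)h_2}w(\boldsymbol x)\\&+\tfrac1{h_2^2}k(x_1,x_2-0.5h_2)e^{-\theta_2(\boldsymbol x,t)h_2}w(\boldsymbol x)-\tfrac1{h_2^2}k(x_1,x_2-0.5h_2)e^{\theta_2(x_1,x_2-h_2,t)h_2}w(x_1,x_2-h_2).\end{aligned}$$ Then the locally one-dimensional scheme $$\frac{y^{n+\alpha/2}-y^{n+(\alpha-1)/2}}\tau+A_\alpha\big(\sigma y^{n+\alpha/2}+(1-\sigma)y^{n+(\alpha-1)/2}\big)=\varphi_\alpha^n,\quad \alpha=1,2,\ n=0,1,\dots,\qquad y^0=u^0,$$ with $\varphi_1^n=0$, $\varphi_2^n=\varphi^n$, is monotone, and its solution satisfies $$\|y^{n+1}\|\le\|u^0\|+\sum_{k=0}^n\tau\|\varphi^k\|$$ in $L_\infty$ in case a (respectively, in $L_1$ in case b), for any $\tau>0$ if $\sigma=1$, and, if $0\le\sigma<1$, under the constraint $\tau\le\frac1{(1-\sigma)\gamma}$ with $$\begin{aligned}\gamma=\max_{\boldsymbol x\in\omega}\Big\{&\tfrac1{h_1^2}k(x_1+0.5h_1,x_2)e^{\theta_1(\boldsymbol x,t)h_1}+\tfrac1{h_1^2}k(x_1-0.5h_1,x_2)e^{-\theta_1(\boldsymbol x,t)h_1},\\&\tfrac1{h_2^2}k(x_1,x_2+0.5h_2)e^{\theta_2(\boldsymbol x,t)h_2}+\tfrac1{h_2^2}k(x_1,x_2-0.5h_2)e^{-\theta_2(\boldsymbol x,t)h_2}\Big\}\end{aligned}$$ (the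 maximum over $\boldsymbol x\in\omega$ of the larger of the two listed quantities).
   Context: For $\alpha=1,2$: $\bar\omega_\alpha=\{ih_\alpha: i=0,\dots,N_\alpha\}$, $N_\alpha h_\alpha=l_\alpha$, $\omega_\alpha=\{ih_\alpha: i=1,\dots,N_\alpha-1\}$; $\bar\omega=\bar\omega_1\times\bar\omega_2$, $\omega=\omega_1\times\omega_2$, $\partial\omega=\bar\omega\setminus\omega$, $\boldsymbol x=(x_1,x_2)$. $k(\boldsymbol x)\ge\kappa_1>0$ and $v_1(\boldsymbol x,t),v_2(\boldsymbol x,t)$ are given real functions on $[0,l_1]\times[0,l_2]$ (and times in $[0,T]$), and $\theta_\alpha(\boldsymbol x,t)=\frac{v_\alpha(\boldsymbol x,t)}{2k(\boldsymbol x)}$. Grid functions are identified with vectors indexed by $\omega$, $\|w\|_\infty=\max_{\boldsymbol x\in\omega}|w(\boldsymbol x)|$, $\|w\|_1=\sum_{\boldsymbol x\in\omega}|w(\boldsymbol x)|$. $\tau>0$ is the time step, $t^n=n\tau$; in the step from $t^n$ to $t^{n+1}$ the operators $A_\alpha$ are taken at a time $t\in[t^n,t^{n+1}]$, e.g. $t=\sigma t^{n+1}+(1-\sigma)t^n$, and the time-step constraint is required at these times. The scheme is monotone if $u^0\ge0$ and $\varphi^n\ge0$ for all $n$ imply $y^{n+1}\ge0$ for all $n$. *)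

theory Defs imports Complex_Main begin

text \<open>
  Quantities carrying a coordinate index \<open>\<alpha> = 1, 2\<close> (\<open>N\<close>, \<open>h\<close>, \<open>v\<close>, ...) are functions of a natural
  number, of which only the values at 1 and 2 are used. Grid functions are functions on the plane,
  of which only the values at grid nodes are used.
\<close>

type_synonym grid_fun = "real \<times> real \<Rightarrow> real"

definition closed_grid :: "(nat \<Rightarrow> nat) \<Rightarrow> (nat \<Rightarrow> real) \<Rightarrow> (real \<times> real) set" where
  "closed_grid N h = (\<lambda>i. real i * h 1) ` {0..N 1} \<times> (\<lambda>i. real i * h 2) ` {0..N 2}"

definition inner_grid :: "(nat \<Rightarrow> nat) \<Rightarrow> (nat \<Rightarrow> real) \<Rightarrow> (real \<times> real) set" where
  "inner_grid N h = (\<lambda>i. real i * h 1) ` {1..N 1 - 1} \<times> (\<lambda>i. real i * h 2) ` {1..N 2 - 1}"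

definition boundary_grid :: "(nat \<Rightarrow> nat) \<Rightarrow> (nat \<Rightarrow> real) \<Rightarrow> (real \<times> real) set" where
  "boundary_grid N h = closed_grid N h - inner_grid N h"

definition norm_Linf :: "(nat \<Rightarrow> nat) \<Rightarrow> (nat \<Rightarrow> real) \<Rightarrow> grid_fun \<Rightarrow> real" where
  "norm_Linf N h w = Max ((\<lambda>x. \<bar>w x\<bar>) ` inner_grid N h)"

definition norm_L1 :: "(nat \<Rightarrow> nat) \<Rightarrow> (nat \<Rightarrow> real) \<Rightarrow> grid_fun \<Rightarrow> real" where
  "norm_L1 N h w = (\<Sum>x\<in>inner_grid N h. \<bar>w x\<bar>)"

definition theta ::
  "(real \<times> real \<Rightarrow> real) \<Rightarrow> (nat \<Rightarrow> real \<times> real \<Rightarrow> real \<Rightarrow> real) \<Rightarrow> nat \<Rightarrow> real \<times> real \<Rightarrow> real \<Rightarrow> real" where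
  "theta k v \<alpha> x t = v \<alpha> x t / (2 * k x)"

definition op_a ::
  "(nat \<Rightarrow> real) \<Rightarrow> (real \<times> real \<Rightarrow> real) \<Rightarrow> (nat \<Rightarrow> real \<times> real \<Rightarrow> real \<Rightarrow> real)
    \<Rightarrow> nat \<Rightarrow> real \<Rightarrow> grid_fun \<Rightarrow> grid_fun" where
  "op_a h k v \<alpha> t w = (\<lambda>(x1, x2).
    if \<alpha> = 1 then
      - (1 / (h 1)\<^sup>2) * k (x1 + h 1 / 2, x2) * exp (theta k v 1 (x1, x2) t * h 1)
          * (w (x1 + h 1, x2) - w (x1, x2))
      + (1 / (h 1)\<^sup>2) * k (x1 - h 1 / 2, x2) * exp (- theta k v 1 (x1, x2) t * h 1)
          * (w (x1, x2) - w (x1 - h 1, x2))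
    else
      - (1 / (h 2)\<^sup>2) * k (x1, x2 + h 2 / 2) * exp (theta k v 2 (x1, x2) t * h 2)
          * (w (x1, x2 + h 2) - w (x1, x2))
      + (1 / (h 2)\<^sup>2) * k (x1, x2 - h 2 / 2) * exp (- theta k v 2 (x1, x2) t * h 2)
          * (w (x1, x2) - w (x1, x2 - h 2)))"

definition op_b ::
  "(nat \<Rightarrow> real) \<Rightarrow> (real \<times> real \<Rightarrow> real) \<Rightarrow> (nat \<Rightarrow> real \<times> real \<Rightarrow> real \<Rightarrow> real)
    \<Rightarrow> nat \<Rightarrow> real \<Rightarrow> grid_fun \<Rightarrow> grid_fun" where
  "op_b h k v \<alpha> t w = (\<lambda>(x1, x2).
    if \<alpha> = 1 then
      - (1 / (h 1)\<^sup>2) * k (x1 + h 1 / 2, x2) * exp (- theta k v 1 (x1 + h 1, x2) t * h 1)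
          * w (x1 + h 1, x2)
      + (1 / (h 1)\<^sup>2) * k (x1 + h 1 / 2, x2) * exp (theta k v 1 (x1, x2) t * h 1)
          * w (x1, x2)
      + (1 / (h 1)\<^sup>2) * k (x1 - h 1 / 2, x2) * exp (- theta k v 1 (x1, x2) t * h 1)
          * w (x1, x2)
      - (1 / (h 1)\<^sup>2) * k (x1 - h 1 / 2, x2) * exp (theta k v 1 (x1 - h 1, x2) t * h 1)
          * w (x1 - h 1, x2)
    else
      - (1 / (h 2)\<^sup>2) * k (x1, x2 + h 2 / 2) * exp (- theta k v 2 (x1, x2 + h 2) t * h 2)
          * w (x1, x2 + h 2)
      + (1 / (h 2)\<^sup>2) * k (x1, x2 + h 2 / 2) * exp (theta k v 2 (x1, x2) t * h 2)
          * w (x1, x2)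
      + (1 / (h 2)\<^sup>2) * k (x1, x2 - h 2 / 2) * exp (- theta k v 2 (x1, x2) t * h 2)
          * w (x1, x2)
      - (1 / (h 2)\<^sup>2) * k (x1, x2 - h 2 / 2) * exp (theta k v 2 (x1, x2 - h 2) t * h 2)
          * w (x1, x2 - h 2))"

definition gam ::
  "(nat \<Rightarrow> nat) \<Rightarrow> (nat \<Rightarrow> real) \<Rightarrow> (real \<times> real \<Rightarrow> real)
    \<Rightarrow> (nat \<Rightarrow> real \<times> real \<Rightarrow> real \<Rightarrow> real) \<Rightarrow> real \<Rightarrow> real" where
  "gam N h k v t = Max ((\<lambda>(x1, x2). max
      ((1 / (h 1)\<^sup>2) * k (x1 + h 1 / 2, x2) * exp (theta k v 1 (x1, x2) t * h 1)
       + (1 / (h 1)\<^sup>2) * k (x1 - h 1 / 2, x2) * exp (- theta k v 1 (x1, x2) t * h 1))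
      ((1 / (h 2)\<^sup>2) * k (x1, x2 + h 2 / 2) * exp (theta k v 2 (x1, x2) t * h 2)
       + (1 / (h 2)\<^sup>2) * k (x1, x2 - h 2 / 2) * exp (- theta k v 2 (x1, x2) t * h 2)))
     ` inner_grid N h)"

text \<open>The steps from \<open>n * \<tau>\<close> to \<open>(n + 1) * \<tau>\<close> that stay within the time interval from 0 to \<open>T\<close>.\<close>

definition time_steps :: "real \<Rightarrow> real \<Rightarrow> nat set" where
  "time_steps \<tau> T = {n. real (n + 1) * \<tau> \<le> T}"

text \<open>
  The sequence \<open>y\<close> is indexed by half steps: \<open>y m\<close> is the grid function at level \<open>m / 2\<close>, so level
  \<open>n + \<alpha> / 2\<close> is \<open>y (2 * n + \<alpha>)\<close> and level \<open>n + 1\<close> is \<open>y (2 * (n + 1))\<close>. In step \<open>n\<close> both operators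
  \<open>A 1\<close> and \<open>A 2\<close> are taken at the time \<open>s n\<close>.
\<close>

definition lod_solution ::
  "(nat \<Rightarrow> nat) \<Rightarrow> (nat \<Rightarrow> real) \<Rightarrow> real \<Rightarrow> real \<Rightarrow> real \<Rightarrow> (nat \<Rightarrow> real)
    \<Rightarrow> (nat \<Rightarrow> real \<Rightarrow> grid_fun \<Rightarrow> grid_fun)
    \<Rightarrow> grid_fun \<Rightarrow> (nat \<Rightarrow> grid_fun) \<Rightarrow> (nat \<Rightarrow> grid_fun) \<Rightarrow> bool" where
  "lod_solution N h T \<tau> \<sigma> s A u0 \<phi> y \<longleftrightarrow>
    (\<forall>x\<in>boundary_grid N h. y 0 x = 0) \<and>
    (\<forall>x\<in>inner_grid N h. y 0 x = u0 x) \<and>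
    (\<forall>n\<in>time_steps \<tau> T. \<forall>\<alpha>\<in>{1, 2}.
      (\<forall>x\<in>boundary_grid N h. y (2 * n + \<alpha>) x = 0) \<and>
      (\<forall>x\<in>inner_grid N h.
        (y (2 * n + \<alpha>) x - y (2 * n + (\<alpha> - 1)) x) / \<tau>
          + A \<alpha> (s n) (\<lambda>z. \<sigma> * y (2 * n + \<alpha>) z + (1 - \<sigma>) * y (2 * n + (\<alpha> - 1)) z) x
        = (if \<alpha> = 1 then 0 else \<phi> n x)))"

text \<open>
  Unique solvability for arbitrary data; values of the solution off the grid, or after time \<open>T\<close>,
  carry no meaning, so uniqueness cannot be equality of the total functions.
\<close>

definition lod_well_posed ::
  "(nat \<Rightarrow> nat) \<Rightarrow> (nat \<Rightarrow> real) \<Rightarrow> real \<Rightarrow> real \<Rightarrow> real \<Rightarrow> (nat \<Rightarrow> real)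
    \<Rightarrow> (nat \<Rightarrow> real \<Rightarrow> grid_fun \<Rightarrow> grid_fun) \<Rightarrow> bool" where
  "lod_well_posed N h T \<tau> \<sigma> s A \<longleftrightarrow>
    (\<forall>u0 \<phi>. \<exists>y. lod_solution N h T \<tau> \<sigma> s A u0 \<phi> y \<and>
      (\<forall>y'. lod_solution N h T \<tau> \<sigma> s A u0 \<phi> y' \<longrightarrow>
        (\<forall>n\<in>time_steps \<tau> T. \<forall>\<alpha>\<in>{1, 2}. \<forall>x\<in>closed_grid N h.
          y' (2 * n + \<alpha>) x = y (2 * n + \<alpha>) x)))"

definition lod_monotone ::
  "(nat \<Rightarrow> nat) \<Rightarrow> (nat \<Rightarrow> real) \<Rightarrow> real \<Rightarrow> real \<Rightarrow> real \<Rightarrow> (nat \<Rightarrow> real)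
    \<Rightarrow> (nat \<Rightarrow> real \<Rightarrow> grid_fun \<Rightarrow> grid_fun) \<Rightarrow> bool" where
  "lod_monotone N h T \<tau> \<sigma> s A \<longleftrightarrow>
    (\<forall>u0 \<phi> y. lod_solution N h T \<tau> \<sigma> s A u0 \<phi> y \<longrightarrow>
      (\<forall>x\<in>inner_grid N h. 0 \<le> u0 x) \<longrightarrow>
      (\<forall>n\<in>time_steps \<tau> T. \<forall>x\<in>inner_grid N h. 0 \<le> \<phi> n x) \<longrightarrow>
      (\<forall>n\<in>time_steps \<tau> T. \<forall>x\<in>inner_grid N h. 0 \<le> y (2 * (n + 1)) x))"

end

theory Submission imports Defs begin

text \<open>
  On grid functions vanishing on the boundary, each \<open>A 1\<close>, \<open>A 2\<close> acts as a matrix with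
  diagonal \<open>d\<close> and off-diagonal part \<open>-C\<close>, where \<open>C \<ge> 0\<close>. In case a the row sums of \<open>C\<close> are
  at most \<open>d\<close>, and the matrix of case b is the transpose of that of case a. Hence in the matching
  norm \<open>1 + \<sigma> \<tau> A\<close> has a contractive nonnegative inverse, while the condition on the time step
  makes \<open>1 - (1 - \<sigma>) \<tau> A\<close> nonnegative and contractive.
\<close>

section \<open>Square linear systems\<close>

text \<open>Contractivity of the implicit part is a statement about subsolutions: if
  \<open>p \<ge> 0\<close> satisfies \<open>(1 + \<mu> * d) * p \<le> \<mu> * C p + g\<close> on the
  inner nodes, then \<open>p\<close> is bounded by \<open>g\<close> in the norm. Evaluating at a
  maximum of \<open>p\<close> proves this in L_inf, summing over all nodes proves it in L_1. An
  inequality is used because \<open>\<bar>w\<bar>\<close> and the negative part of \<open>w\<close>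
  satisfy no equation, only this inequality. The one estimate thus gives stability, nonnegativity
  and injectivity, and injectivity gives existence because the system is square. The constant
  \<open>gam\<close> is the largest diagonal entry over both directions, so the time step constraint
  says that the diagonal of the explicit part stays nonnegative. The matrix form holds only for
  functions vanishing on the boundary, so the boundary values have to be known at every half level
  before a difference equation can be read as a matrix equation.\<close>

lemma square_system_solvable:
  fixes M :: "'a \<Rightarrow> 'b \<Rightarrow> real"
  assumes "finite J" "finite I" "card I = card J"
    and "\<And>w. \<forall>i\<in>I. (\<Sum>j\<in>J. M i j * w j) = 0 \<Longrightarrow> \<forall>j\<in>J. w j = 0"
  shows "\<exists>w. \<forall>i\<in>I. (\<Sum>j\<in>J. M i j * w j) = f i"
  using assms
\<comment> \<open>Gaussian elimination, one column at a time. Rows and columns have separate index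
  sets because the pivot row need not carry the index of the eliminated column.\<close>
proof (induction J arbitrary: I M f rule: finite_induct)
  case empty
  then show ?case by simp
next
  case (insert b J)
  have sum_upd: "(\<Sum>j\<in>J. M i j * (w(b := c)) j) = (\<Sum>j\<in>J. M i j * w j)" for i w c
    by (rule sum.cong) (use insert.hyps in auto)
  \<comment> \<open>Otherwise column \<open>b\<close> vanishes and the unit vector at
    \<open>b\<close> lies in the kernel.\<close>
  have "\<exists>a\<in>I. M a b \<noteq> 0"
  proof (rule ccontr)
    assume "\<not> (\<exists>a\<in>I. M a b \<noteq> 0)"
    then have "\<forall>i\<in>I. (\<Sum>j\<in>insert b J. M i j * ((\<lambda>_. 0)(b := 1)) j) = 0"
      using insert.hyps by (simp add: sum_upd del: fun_upd_apply)
    from insert.prems(3)[OF this] show False by simp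
  qed
  then obtain a where a: "a \<in> I" "M a b \<noteq> 0" by blast
  \<comment> \<open>Row \<open>a\<close> with right-hand side \<open>g\<close>, solved for the
    unknown at \<open>b\<close>; \<open>M'\<close> is the resulting Schur complement. Taking
    \<open>g = 0\<close> lifts kernel vectors of \<open>M'\<close> to kernel vectors of
    \<open>M\<close>, and \<open>g = f a\<close> lifts solutions.\<close>
  define c where "c g w = (g - (\<Sum>j\<in>J. M a j * w j)) / M a b" for g w
  define M' where "M' i j = M i j - M i b / M a b * M a j" for i j
  have ext: "(\<Sum>j\<in>insert b J. M i j * (w(b := c g w)) j)
      = (\<Sum>j\<in>J. M' i j * w j) + M i b / M a b * g" for i w g
  proof -
    have "(\<Sum>j\<in>J. M' i j * w j) = (\<Sum>j\<in>J. M i j * w j) - M i b / M a b * (\<Sum>j\<in>J. M a j * w j)"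
      unfolding M'_def by (simp add: left_diff_distrib sum_subtractf sum_distrib_left mult.assoc)
    moreover have "(\<Sum>j\<in>insert b J. M i j * (w(b := c g w)) j)
        = M i b * c g w + (\<Sum>j\<in>J. M i j * w j)"
      using insert.hyps by (simp add: sum_upd del: fun_upd_apply) simp
    ultimately show ?thesis
      by (simp add: c_def diff_divide_distrib right_diff_distrib)
  qed
  have row_a: "(\<Sum>j\<in>J. M' a j * w j) = 0" for w
    using a by (simp add: M'_def)
  have "\<exists>w. \<forall>i\<in>I - {a}. (\<Sum>j\<in>J. M' i j * w j) = f i - M i b / M a b * f a"
  proof (rule insert.IH)
    show "finite (I - {a})" "card (I - {a}) = card J"
      using insert.prems insert.hyps a by auto
    fix w
    assume w: "\<forall>i\<in>I - {a}. (\<Sum>j\<in>J. M' i j * w j) = 0"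
    have "\<forall>i\<in>I. (\<Sum>j\<in>insert b J. M i j * (w(b := c 0 w)) j) = 0"
      unfolding ext using w row_a by auto
    from insert.prems(3)[OF this] show "\<forall>j\<in>J. w j = 0"
      using insert.hyps by (metis fun_upd_apply insertCI)
  qed
  then obtain w where w: "\<forall>i\<in>I - {a}. (\<Sum>j\<in>J. M' i j * w j) = f i - M i b / M a b * f a"
    by blast
  have "(\<Sum>j\<in>insert b J. M i j * (w(b := c (f a) w)) j) = f i" if "i \<in> I" for i
    unfolding ext using w row_a[of w] that a by (cases "i = a") auto
  then show ?case by blast
qed

section \<open>One step of a two-level scheme\<close>

text \<open>The equation \<open>(1 + \<mu> A) w = (1 - \<nu> A) u + f\<close> on \<open>X\<close>,
  with \<open>A = d - C\<close>. The scheme takes \<open>\<mu> = \<sigma> * \<tau>\<close> and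
  \<open>\<nu> = (1 - \<sigma>) * \<tau>\<close>.\<close>

definition weighted_step ::
  "'a set \<Rightarrow> ('a \<Rightarrow> real) \<Rightarrow> ('a \<Rightarrow> 'a \<Rightarrow> real) \<Rightarrow> real \<Rightarrow> real
    \<Rightarrow> ('a \<Rightarrow> real) \<Rightarrow> ('a \<Rightarrow> real) \<Rightarrow> ('a \<Rightarrow> real) \<Rightarrow> bool" where
  "weighted_step X d C \<mu> \<nu> f u w \<longleftrightarrow>
    (\<forall>x\<in>X. (1 + \<mu> * d x) * w x - \<mu> * (\<Sum>z\<in>X. C x z * w z)
      = (1 - \<nu> * d x) * u x + \<nu> * (\<Sum>z\<in>X. C x z * u z) + f x)"

text \<open>The norm is abstract so that both cases share one theory. \<open>resolvent\<close>
  bounds the implicit part and \<open>forward\<close> the explicit part, both on nonnegative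
  \<open>p\<close> only; \<open>C_nonneg\<close> reduces other functions to their moduli. Functions
  are total, but \<open>nrm_mono\<close> makes the norm depend only on values in
  \<open>X\<close>.\<close>

locale stable_operator =
  fixes X :: "'a set" and nrm :: "('a \<Rightarrow> real) \<Rightarrow> real"
    and d :: "'a \<Rightarrow> real" and C :: "'a \<Rightarrow> 'a \<Rightarrow> real"
  assumes finite_X: "finite X"
    and d_nonneg: "x \<in> X \<Longrightarrow> 0 \<le> d x"
    and C_nonneg: "x \<in> X \<Longrightarrow> z \<in> X \<Longrightarrow> 0 \<le> C x z"
    and nrm_mono: "(\<And>x. x \<in> X \<Longrightarrow> \<bar>u x\<bar> \<le> \<bar>w x\<bar>) \<Longrightarrow> nrm u \<le> nrm w"
    and nrm_add: "nrm (\<lambda>x. u x + w x) \<le> nrm u + nrm w"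
    and nrm_zero: "nrm (\<lambda>_. 0) = 0"
    and nrm_definite: "nrm u \<le> 0 \<Longrightarrow> x \<in> X \<Longrightarrow> u x = 0"
    and resolvent: "0 \<le> \<mu> \<Longrightarrow> (\<And>x. x \<in> X \<Longrightarrow> 0 \<le> p x) \<Longrightarrow>
      (\<And>x. x \<in> X \<Longrightarrow> (1 + \<mu> * d x) * p x \<le> \<mu> * (\<Sum>z\<in>X. C x z * p z) + g x) \<Longrightarrow>
      nrm p \<le> nrm g"
    and forward: "0 \<le> \<nu> \<Longrightarrow> (\<And>x. x \<in> X \<Longrightarrow> \<nu> * d x \<le> 1) \<Longrightarrow> (\<And>x. x \<in> X \<Longrightarrow> 0 \<le> p x) \<Longrightarrow>
      nrm (\<lambda>x. (1 - \<nu> * d x) * p x + \<nu> * (\<Sum>z\<in>X. C x z * p z)) \<le> nrm p"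
begin

lemma abs_C_sum_le: "x \<in> X \<Longrightarrow> \<bar>\<Sum>z\<in>X. C x z * u z\<bar> \<le> (\<Sum>z\<in>X. C x z * \<bar>u z\<bar>)"
  by (rule order_trans[OF sum_abs]) (auto intro!: sum_mono simp: abs_mult C_nonneg)

lemma step_norm_le:
  assumes "0 \<le> \<mu>" "0 \<le> \<nu>" "\<And>x. x \<in> X \<Longrightarrow> \<nu> * d x \<le> 1" "weighted_step X d C \<mu> \<nu> f u w"
  shows "nrm w \<le> nrm u + nrm f"
proof -
  \<comment> \<open>The explicit side with moduli of \<open>u\<close> and \<open>f\<close>: taking
    absolute values in the equation makes \<open>\<bar>w\<bar>\<close> a subsolution for it.\<close>
  let ?g = "\<lambda>x. ((1 - \<nu> * d x) * \<bar>u x\<bar> + \<nu> * (\<Sum>z\<in>X. C x z * \<bar>u z\<bar>)) + \<bar>f x\<bar>"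
  have "nrm w \<le> nrm (\<lambda>x. \<bar>w x\<bar>)" by (rule nrm_mono) simp
  also have "\<dots> \<le> nrm ?g"
  proof (rule resolvent[OF assms(1)])
    fix x assume x: "x \<in> X"
    have "(1 + \<mu> * d x) * \<bar>w x\<bar> = \<bar>(1 + \<mu> * d x) * w x\<bar>"
      using assms(1) d_nonneg[OF x] by (simp add: abs_mult)
    also have "(1 + \<mu> * d x) * w x = \<mu> * (\<Sum>z\<in>X. C x z * w z)
        + ((1 - \<nu> * d x) * u x + \<nu> * (\<Sum>z\<in>X. C x z * u z) + f x)"
      using assms(4) x unfolding weighted_step_def by (auto simp: algebra_simps)
    also have "\<bar>\<dots>\<bar> \<le> \<bar>\<mu> * (\<Sum>z\<in>X. C x z * w z)\<bar> + (\<bar>(1 - \<nu> * d x) * u x\<bar>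
        + \<bar>\<nu> * (\<Sum>z\<in>X. C x z * u z)\<bar> + \<bar>f x\<bar>)"
      by linarith
    also have "\<dots> = \<mu> * \<bar>\<Sum>z\<in>X. C x z * w z\<bar> + ((1 - \<nu> * d x) * \<bar>u x\<bar>
        + \<nu> * \<bar>\<Sum>z\<in>X. C x z * u z\<bar> + \<bar>f x\<bar>)"
      using assms(1,2) assms(3)[OF x] by (simp add: abs_mult)
    also have "\<dots> \<le> \<mu> * (\<Sum>z\<in>X. C x z * \<bar>w z\<bar>) + ?g x"
      using abs_C_sum_le[OF x, of u] abs_C_sum_le[OF x, of w] assms(1,2) assms(3)[OF x]
      by (intro add_mono mult_left_mono) auto
    finally show "(1 + \<mu> * d x) * \<bar>w x\<bar> \<le> \<mu> * (\<Sum>z\<in>X. C x z * \<bar>w z\<bar>) + ?g x" .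
  qed simp
  also have "\<dots> \<le> nrm (\<lambda>x. (1 - \<nu> * d x) * \<bar>u x\<bar> + \<nu> * (\<Sum>z\<in>X. C x z * \<bar>u z\<bar>)) + nrm (\<lambda>x. \<bar>f x\<bar>)"
    by (rule nrm_add)
  also have "\<dots> \<le> nrm u + nrm f"
  proof (rule add_mono)
    have "nrm (\<lambda>x. (1 - \<nu> * d x) * \<bar>u x\<bar> + \<nu> * (\<Sum>z\<in>X. C x z * \<bar>u z\<bar>)) \<le> nrm (\<lambda>x. \<bar>u x\<bar>)"
      using assms(2,3) by (intro forward) auto
    also have "\<dots> \<le> nrm u" by (rule nrm_mono) simp
    finally show "nrm (\<lambda>x. (1 - \<nu> * d x) * \<bar>u x\<bar> + \<nu> * (\<Sum>z\<in>X. C x z * \<bar>u z\<bar>)) \<le> nrm u" .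
    show "nrm (\<lambda>x. \<bar>f x\<bar>) \<le> nrm f" by (rule nrm_mono) simp
  qed
  finally show ?thesis .
qed

text \<open>The resolvent bound is applied to the negative part of \<open>w\<close>, with zero right-hand side.\<close>

lemma step_nonneg:
  assumes "0 \<le> \<mu>" "0 \<le> \<nu>" "\<And>x. x \<in> X \<Longrightarrow> \<nu> * d x \<le> 1" "weighted_step X d C \<mu> \<nu> f u w"
    and "\<And>x. x \<in> X \<Longrightarrow> 0 \<le> u x" "\<And>x. x \<in> X \<Longrightarrow> 0 \<le> f x" and x: "x \<in> X"
  shows "0 \<le> w x"
proof -
  have "nrm (\<lambda>x. max 0 (- w x)) \<le> nrm (\<lambda>_. 0)"
  proof (rule resolvent[OF assms(1)])
    fix x assume x: "x \<in> X"
    have Cp: "0 \<le> (\<Sum>z\<in>X. C x z * max 0 (- w z))"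
      using C_nonneg[OF x] by (intro sum_nonneg) auto
    have "(\<Sum>z\<in>X. C x z * (- w z)) \<le> (\<Sum>z\<in>X. C x z * max 0 (- w z))"
      using C_nonneg[OF x] by (intro sum_mono mult_left_mono) auto
    then have le: "\<mu> * - (\<Sum>z\<in>X. C x z * w z) \<le> \<mu> * (\<Sum>z\<in>X. C x z * max 0 (- w z))"
      using assms(1) by (intro mult_left_mono) (auto simp: sum_negf)
    have "0 \<le> (1 - \<nu> * d x) * u x" "0 \<le> \<nu> * (\<Sum>z\<in>X. C x z * u z)"
      using assms(2,5) assms(3)[OF x] C_nonneg[OF x] x
      by (auto intro!: mult_nonneg_nonneg sum_nonneg)
    moreover have "(1 + \<mu> * d x) * w x - \<mu> * (\<Sum>z\<in>X. C x z * w z)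
        = (1 - \<nu> * d x) * u x + \<nu> * (\<Sum>z\<in>X. C x z * u z) + f x"
      using assms(4) x unfolding weighted_step_def by blast
    ultimately have "(1 + \<mu> * d x) * - w x \<le> \<mu> * (\<Sum>z\<in>X. C x z * max 0 (- w z))"
      using le assms(6)[OF x] unfolding mult_minus_right by linarith
    \<comment> \<open>Where \<open>w x\<close> is positive the left side is zero and
      \<open>Cp\<close> suffices; elsewhere the maximum is \<open>- w x\<close>.\<close>
    then show "(1 + \<mu> * d x) * max 0 (- w x) \<le> \<mu> * (\<Sum>z\<in>X. C x z * max 0 (- w z)) + 0"
      using Cp assms(1) by (cases "w x \<le> 0") auto
  qed simp
  with nrm_definite[of "\<lambda>x. max 0 (- w x)", OF _ x] show ?thesis by (simp add: nrm_zero)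
qed

text \<open>The stability bound with zero data and \<open>\<nu> = 0\<close> leaves a function of
  norm at most 0.\<close>

lemma resolvent_injective:
  assumes "0 \<le> \<mu>"
    and "\<And>x. x \<in> X \<Longrightarrow> (1 + \<mu> * d x) * w x - \<mu> * (\<Sum>z\<in>X. C x z * w z) = 0"
    and "x \<in> X"
  shows "w x = 0"
proof -
  have "weighted_step X d C \<mu> 0 (\<lambda>_. 0) (\<lambda>_. 0) w"
    unfolding weighted_step_def using assms(2) by simp
  then have "nrm w \<le> nrm (\<lambda>_. 0) + nrm (\<lambda>_. 0)"
    using assms(1) by (intro step_norm_le) auto
  then show ?thesis using nrm_definite assms(3) by (simp add: nrm_zero)
qed

lemma step_unique:
  assumes "0 \<le> \<mu>" "weighted_step X d C \<mu> \<nu> f u w" "weighted_step X d C \<mu> \<nu> f u' w'"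
    and "\<And>x. x \<in> X \<Longrightarrow> u x = u' x" "x \<in> X"
  shows "w x = w' x"
proof -
  have "w x - w' x = 0"
  proof (rule resolvent_injective[OF assms(1) _ assms(5)])
    fix x assume x: "x \<in> X"
    have "(\<Sum>z\<in>X. C x z * u z) = (\<Sum>z\<in>X. C x z * u' z)"
      using assms(4) by (intro sum.cong) auto
    with assms(2,3,4) x
    have "(1 + \<mu> * d x) * w x - \<mu> * (\<Sum>z\<in>X. C x z * w z)
        = (1 + \<mu> * d x) * w' x - \<mu> * (\<Sum>z\<in>X. C x z * w' z)"
      unfolding weighted_step_def by simp
    then show "(1 + \<mu> * d x) * (w x - w' x) - \<mu> * (\<Sum>z\<in>X. C x z * (w z - w' z)) = 0"
      by (simp add: right_diff_distrib sum_subtractf)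
  qed
  then show ?thesis by simp
qed

text \<open>Injectivity of a square system yields a solution. It is extended by 0 off
  \<open>X\<close> to provide the boundary values that the scheme prescribes.\<close>

lemma step_exists:
  assumes "0 \<le> \<mu>"
  shows "\<exists>w. weighted_step X d C \<mu> \<nu> f u w \<and> (\<forall>x. x \<notin> X \<longrightarrow> w x = 0)"
proof -
  define M where "M x z = (if z = x then 1 + \<mu> * d x else 0) - \<mu> * C x z" for x z
  have M: "(\<Sum>z\<in>X. M x z * w z) = (1 + \<mu> * d x) * w x - \<mu> * (\<Sum>z\<in>X. C x z * w z)"
    if "x \<in> X" for x w
  proof -
    have "(\<Sum>z\<in>X. M x z * w z)
        = (\<Sum>z\<in>X. (if z = x then (1 + \<mu> * d x) * w z else 0) - \<mu> * (C x z * w z))"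
      by (rule sum.cong) (auto simp: M_def left_diff_distrib)
    then show ?thesis
      using that finite_X by (simp add: sum_subtractf sum_distrib_left)
  qed
  have inj: "\<forall>x\<in>X. w x = 0" if w: "\<forall>x\<in>X. (\<Sum>z\<in>X. M x z * w z) = 0" for w
  proof
    fix x assume "x \<in> X"
    show "w x = 0"
    proof (rule resolvent_injective[OF assms _ \<open>x \<in> X\<close>])
      fix x assume "x \<in> X"
      with w M[OF this, of w] show "(1 + \<mu> * d x) * w x - \<mu> * (\<Sum>z\<in>X. C x z * w z) = 0"
        by metis
    qed
  qed
  define g where "g x = (1 - \<nu> * d x) * u x + \<nu> * (\<Sum>z\<in>X. C x z * u z) + f x" for x
  obtain w where "\<forall>x\<in>X. (\<Sum>z\<in>X. M x z * w z) = g x"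
    using square_system_solvable[OF finite_X finite_X refl inj] by blast
  then have w: "weighted_step X d C \<mu> \<nu> f u w"
    by (simp add: weighted_step_def M g_def)
  have "(\<Sum>z\<in>X. C x z * (if z \<in> X then w z else 0)) = (\<Sum>z\<in>X. C x z * w z)" for x
    by (rule sum.cong) auto
  with w have "weighted_step X d C \<mu> \<nu> f u (\<lambda>x. if x \<in> X then w x else 0)"
    by (simp add: weighted_step_def)
  then show ?thesis by (intro exI conjI) auto
qed

end

section \<open>Row sums and the maximum norm, column sums and the sum norm\<close>

lemma stable_operator_Max:
  assumes fin: "finite X" and ne: "X \<noteq> {}"
    and C: "\<And>x z. x \<in> X \<Longrightarrow> z \<in> X \<Longrightarrow> 0 \<le> C x z"
    and rows: "\<And>x. x \<in> X \<Longrightarrow> (\<Sum>z\<in>X. C x z) \<le> d x"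
  shows "stable_operator X (\<lambda>w. Max ((\<lambda>x. \<bar>w x\<bar>) ` X)) d C"
proof -
  let ?nrm = "\<lambda>w :: _ \<Rightarrow> real. Max ((\<lambda>x. \<bar>w x\<bar>) ` X)"
  have le: "\<bar>w x\<bar> \<le> ?nrm w" if "x \<in> X" for x w
    using fin that by simp
  have least: "?nrm w \<le> b" if "\<And>x. x \<in> X \<Longrightarrow> \<bar>w x\<bar> \<le> b" for b w
    using fin ne that by (subst Max_le_iff) auto
  have d: "0 \<le> d x" if "x \<in> X" for x
    using order_trans[OF sum_nonneg rows[OF that]] C that by blast
  have row_le: "(\<Sum>z\<in>X. C x z * w z) \<le> d x * b"
    if "x \<in> X" "0 \<le> b" "\<And>z. z \<in> X \<Longrightarrow> w z \<le> b" for x w b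
  proof -
    have "(\<Sum>z\<in>X. C x z * w z) \<le> (\<Sum>z\<in>X. C x z * b)"
      using that C by (intro sum_mono mult_left_mono) auto
    also have "\<dots> \<le> d x * b"
      using rows that by (simp add: sum_distrib_right[symmetric] mult_right_mono)
    finally show ?thesis .
  qed
  show ?thesis
  proof
    show "finite X" by fact
    show "0 \<le> d x" if "x \<in> X" for x using d that .
    show "0 \<le> C x z" if "x \<in> X" "z \<in> X" for x z using C that .
    show "?nrm u \<le> ?nrm w" if "\<And>x. x \<in> X \<Longrightarrow> \<bar>u x\<bar> \<le> \<bar>w x\<bar>" for u w
      using that le by (intro least) (meson order_trans)
    show "?nrm (\<lambda>x. u x + w x) \<le> ?nrm u + ?nrm w" for u w
    proof (rule least)
      fix x assume "x \<in> X"
      with le[of x u] le[of x w] show "\<bar>u x + w x\<bar> \<le> ?nrm u + ?nrm w" by linarith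
    qed
    show "?nrm (\<lambda>_. 0) = 0" using ne by (simp add: image_constant_conv)
    show "u x = 0" if "?nrm u \<le> 0" "x \<in> X" for u x
      using le[OF that(2), of u] that(1) by simp
    show "?nrm p \<le> ?nrm g"
      if \<mu>: "0 \<le> \<mu>" and p: "\<And>x. x \<in> X \<Longrightarrow> 0 \<le> p x"
        and ineq: "\<And>x. x \<in> X \<Longrightarrow> (1 + \<mu> * d x) * p x \<le> \<mu> * (\<Sum>z\<in>X. C x z * p z) + g x"
      for \<mu> p g
    proof -
      \<comment> \<open>Discrete maximum principle: at a node where \<open>p\<close> is largest, the
        row sum bound gives \<open>C p \<le> d * p\<close>, so the terms with \<open>\<mu>\<close>
        cancel and \<open>p x \<le> g x\<close> remains.\<close>
      have "?nrm p \<in> (\<lambda>x. \<bar>p x\<bar>) ` X" using fin ne by (intro Max_in) auto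
      then obtain x where x: "x \<in> X" "?nrm p = p x" using p by auto
      have "(\<Sum>z\<in>X. C x z * p z) \<le> d x * p x"
        using le[of _ p] p x by (intro row_le) force+
      then have "\<mu> * (\<Sum>z\<in>X. C x z * p z) \<le> \<mu> * (d x * p x)"
        using \<mu> by (rule mult_left_mono)
      with ineq[OF x(1)] have "p x \<le> g x" by (simp add: algebra_simps)
      with le[OF x(1), of g] x(2) show ?thesis by linarith
    qed
    show "?nrm (\<lambda>x. (1 - \<nu> * d x) * p x + \<nu> * (\<Sum>z\<in>X. C x z * p z)) \<le> ?nrm p"
      if \<nu>: "0 \<le> \<nu>" and le1: "\<And>x. x \<in> X \<Longrightarrow> \<nu> * d x \<le> 1" and p: "\<And>x. x \<in> X \<Longrightarrow> 0 \<le> p x"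
      for \<nu> p
    proof (rule least)
      fix x assume x: "x \<in> X"
      have p_le: "p z \<le> ?nrm p" if "z \<in> X" for z using le[OF that, of p] by linarith
      have "0 \<le> ?nrm p" using le[OF x, of p] by linarith
      \<comment> \<open>The coefficients of the explicit part are nonnegative and their row sum is
        at most \<open>1 - \<nu> * d x + \<nu> * d x = 1\<close>.\<close>
      then have "(1 - \<nu> * d x) * p x + \<nu> * (\<Sum>z\<in>X. C x z * p z)
          \<le> (1 - \<nu> * d x) * ?nrm p + \<nu> * (d x * ?nrm p)"
        using \<nu> le1[OF x] p_le x row_le[OF x _ p_le] by (intro add_mono mult_left_mono) auto
      moreover have "0 \<le> (1 - \<nu> * d x) * p x" "0 \<le> \<nu> * (\<Sum>z\<in>X. C x z * p z)"
        using \<nu> le1[OF x] p C x by (auto intro!: mult_nonneg_nonneg sum_nonneg)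
      ultimately show "\<bar>(1 - \<nu> * d x) * p x + \<nu> * (\<Sum>z\<in>X. C x z * p z)\<bar> \<le> ?nrm p"
        by (simp add: algebra_simps)
    qed
  qed
qed

lemma stable_operator_sum:
  assumes fin: "finite X"
    and C: "\<And>x z. x \<in> X \<Longrightarrow> z \<in> X \<Longrightarrow> 0 \<le> C x z"
    and cols: "\<And>z. z \<in> X \<Longrightarrow> (\<Sum>x\<in>X. C x z) \<le> d z"
  shows "stable_operator X (\<lambda>w. \<Sum>x\<in>X. \<bar>w x\<bar>) d C"
proof -
  have d: "0 \<le> d x" if "x \<in> X" for x
    using order_trans[OF sum_nonneg cols[OF that]] C that by blast
  \<comment> \<open>Exchanging the two summations turns the column bounds into a bound on the total
    of \<open>C p\<close>; it plays the part that evaluation at a maximum plays for the other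
    norm.\<close>
  have col_le: "(\<Sum>x\<in>X. \<Sum>z\<in>X. C x z * p z) \<le> (\<Sum>z\<in>X. d z * p z)"
    if "\<And>x. x \<in> X \<Longrightarrow> 0 \<le> p x" for p
  proof -
    have "(\<Sum>x\<in>X. \<Sum>z\<in>X. C x z * p z) = (\<Sum>z\<in>X. (\<Sum>x\<in>X. C x z) * p z)"
      by (subst sum.swap) (simp add: sum_distrib_right)
    also have "\<dots> \<le> (\<Sum>z\<in>X. d z * p z)"
      using cols that by (intro sum_mono mult_right_mono) auto
    finally show ?thesis .
  qed
  show ?thesis
  proof
    show "finite X" by fact
    show "0 \<le> d x" if "x \<in> X" for x using d that .
    show "0 \<le> C x z" if "x \<in> X" "z \<in> X" for x z using C that .
    show "(\<Sum>x\<in>X. \<bar>u x\<bar>) \<le> (\<Sum>x\<in>X. \<bar>w x\<bar>)"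
      if "\<And>x. x \<in> X \<Longrightarrow> \<bar>u x\<bar> \<le> \<bar>w x\<bar>" for u w :: "'a \<Rightarrow> real"
      using that by (rule sum_mono)
    show "(\<Sum>x\<in>X. \<bar>u x + w x\<bar>) \<le> (\<Sum>x\<in>X. \<bar>u x\<bar>) + (\<Sum>x\<in>X. \<bar>w x\<bar>)" for u w :: "'a \<Rightarrow> real"
      by (simp add: sum.distrib[symmetric] sum_mono abs_triangle_ineq)
    show "(\<Sum>x\<in>X. \<bar>0 :: real\<bar>) = 0" by simp
    show "u x = 0" if "(\<Sum>x\<in>X. \<bar>u x\<bar>) \<le> 0" "x \<in> X" for u :: "'a \<Rightarrow> real" and x
      using that fin member_le_sum[of x X "\<lambda>x. \<bar>u x\<bar>"] by simp
    show "(\<Sum>x\<in>X. \<bar>p x\<bar>) \<le> (\<Sum>x\<in>X. \<bar>g x\<bar>)"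
      if \<mu>: "0 \<le> \<mu>" and p: "\<And>x. x \<in> X \<Longrightarrow> 0 \<le> p x"
        and ineq: "\<And>x. x \<in> X \<Longrightarrow> (1 + \<mu> * d x) * p x \<le> \<mu> * (\<Sum>z\<in>X. C x z * p z) + g x"
      for \<mu> p g
    proof -
      have "(\<Sum>x\<in>X. p x) + \<mu> * (\<Sum>x\<in>X. d x * p x) = (\<Sum>x\<in>X. (1 + \<mu> * d x) * p x)"
        by (simp add: distrib_right sum.distrib sum_distrib_left mult.assoc)
      also have "\<dots> \<le> (\<Sum>x\<in>X. \<mu> * (\<Sum>z\<in>X. C x z * p z) + g x)"
        using ineq by (rule sum_mono)
      also have "\<dots> = \<mu> * (\<Sum>x\<in>X. \<Sum>z\<in>X. C x z * p z) + (\<Sum>x\<in>X. g x)"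
        by (simp add: sum.distrib sum_distrib_left)
      also have "\<dots> \<le> \<mu> * (\<Sum>x\<in>X. d x * p x) + (\<Sum>x\<in>X. \<bar>g x\<bar>)"
        using \<mu> p by (intro add_mono mult_left_mono col_le sum_mono) auto
      finally show ?thesis using p by simp
    qed
    show "(\<Sum>x\<in>X. \<bar>(1 - \<nu> * d x) * p x + \<nu> * (\<Sum>z\<in>X. C x z * p z)\<bar>) \<le> (\<Sum>x\<in>X. \<bar>p x\<bar>)"
      if \<nu>: "0 \<le> \<nu>" and le1: "\<And>x. x \<in> X \<Longrightarrow> \<nu> * d x \<le> 1" and p: "\<And>x. x \<in> X \<Longrightarrow> 0 \<le> p x"
      for \<nu> p
    proof -
      have "(\<Sum>x\<in>X. \<bar>(1 - \<nu> * d x) * p x + \<nu> * (\<Sum>z\<in>X. C x z * p z)\<bar>)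
          = (\<Sum>x\<in>X. (1 - \<nu> * d x) * p x + \<nu> * (\<Sum>z\<in>X. C x z * p z))"
        using \<nu> le1 p C
        by (intro sum.cong refl abs_of_nonneg add_nonneg_nonneg mult_nonneg_nonneg sum_nonneg) auto
      also have "\<dots> = (\<Sum>x\<in>X. p x) - \<nu> * (\<Sum>x\<in>X. d x * p x) + \<nu> * (\<Sum>x\<in>X. \<Sum>z\<in>X. C x z * p z)"
        by (simp add: left_diff_distrib sum.distrib sum_subtractf sum_distrib_left mult.assoc)
      also have "\<dots> \<le> (\<Sum>x\<in>X. p x)"
        using mult_left_mono[OF col_le[OF p] \<nu>] by simp
      finally show ?thesis using p by simp
    qed
  qed
qed

section \<open>The locally one-dimensional scheme\<close>

lemma closed_grid_eq: "closed_grid N h = inner_grid N h \<union> boundary_grid N h"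
proof -
  have "inner_grid N h \<subseteq> closed_grid N h"
    unfolding inner_grid_def closed_grid_def by (intro Sigma_mono image_mono) auto
  then show ?thesis unfolding boundary_grid_def by blast
qed

lemma finite_inner_grid: "finite (inner_grid N h)"
  unfolding inner_grid_def by simp

text \<open>Lets an induction over \<open>n\<close> carry membership in \<open>time_steps\<close> as
  a premise and still use the previous step.\<close>

lemma time_steps_downward: "n \<in> time_steps \<tau> T \<Longrightarrow> m \<le> n \<Longrightarrow> 0 < \<tau> \<Longrightarrow> m \<in> time_steps \<tau> T"
  unfolding time_steps_def by (auto elim!: order_trans[rotated] intro!: mult_right_mono)

text \<open>\<open>d\<close> and \<open>C\<close> depend on \<open>n\<close> because the operators
  are frozen at \<open>s n\<close> in each step. \<open>nrm_scale\<close> serves the source, which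
  appears as \<open>\<tau> * f\<close> once the equation is multiplied by
  \<open>\<tau>\<close>.\<close>

locale lod_scheme =
  fixes N :: "nat \<Rightarrow> nat" and h :: "nat \<Rightarrow> real" and T \<tau> \<sigma> :: real and s :: "nat \<Rightarrow> real"
    and A :: "nat \<Rightarrow> real \<Rightarrow> grid_fun \<Rightarrow> grid_fun"
    and nrm :: "grid_fun \<Rightarrow> real"
    and d :: "nat \<Rightarrow> nat \<Rightarrow> grid_fun" and C :: "nat \<Rightarrow> nat \<Rightarrow> real \<times> real \<Rightarrow> grid_fun"
  assumes tau: "0 < \<tau>" and sigma: "0 \<le> \<sigma>" "\<sigma> \<le> 1"
    and nrm_scale: "nrm (\<lambda>x. \<tau> * u x) \<le> \<tau> * nrm u"
    and stable: "n \<in> time_steps \<tau> T \<Longrightarrow> \<alpha> \<in> {1, 2} \<Longrightarrow>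
      stable_operator (inner_grid N h) nrm (d n \<alpha>) (C n \<alpha>)"
    and matrix: "n \<in> time_steps \<tau> T \<Longrightarrow> \<alpha> \<in> {1, 2} \<Longrightarrow>
      \<forall>x\<in>boundary_grid N h. w x = 0 \<Longrightarrow> x \<in> inner_grid N h \<Longrightarrow>
      A \<alpha> (s n) w x = d n \<alpha> x * w x - (\<Sum>z\<in>inner_grid N h. C n \<alpha> x z * w z)"
    and step_size: "n \<in> time_steps \<tau> T \<Longrightarrow> \<alpha> \<in> {1, 2} \<Longrightarrow> x \<in> inner_grid N h \<Longrightarrow>
      (1 - \<sigma>) * \<tau> * d n \<alpha> x \<le> 1"
begin

abbreviation half_step :: "nat \<Rightarrow> nat \<Rightarrow> grid_fun \<Rightarrow> grid_fun \<Rightarrow> grid_fun \<Rightarrow> bool" where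
  "half_step n \<alpha> f \<equiv>
    weighted_step (inner_grid N h) (d n \<alpha>) (C n \<alpha>) (\<sigma> * \<tau>) ((1 - \<sigma>) * \<tau>) (\<lambda>x. \<tau> * f x)"

abbreviation source :: "(nat \<Rightarrow> grid_fun) \<Rightarrow> nat \<Rightarrow> nat \<Rightarrow> grid_fun" where
  "source \<phi> n \<alpha> \<equiv> \<lambda>x. if \<alpha> = 1 then 0 else \<phi> n x"

lemma weights: "0 \<le> \<sigma> * \<tau>" "0 \<le> (1 - \<sigma>) * \<tau>"
  using tau sigma by auto

lemma half_step_iff:
  assumes "n \<in> time_steps \<tau> T" "\<alpha> \<in> {1, 2}"
    and "\<forall>x\<in>boundary_grid N h. u x = 0" "\<forall>x\<in>boundary_grid N h. w x = 0"
  shows "(\<forall>x\<in>inner_grid N h. (w x - u x) / \<tau>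
      + A \<alpha> (s n) (\<lambda>z. \<sigma> * w z + (1 - \<sigma>) * u z) x = f x) \<longleftrightarrow> half_step n \<alpha> f u w"
  unfolding weighted_step_def
proof (rule ball_cong[OF refl])
  fix x assume x: "x \<in> inner_grid N h"
  let ?S = "\<lambda>w. \<Sum>z\<in>inner_grid N h. C n \<alpha> x z * w z"
  have "?S (\<lambda>z. \<sigma> * w z + (1 - \<sigma>) * u z) = \<sigma> * ?S w + (1 - \<sigma>) * ?S u"
    unfolding sum_distrib_left sum.distrib[symmetric] by (rule sum.cong) (auto simp: algebra_simps)
  \<comment> \<open>\<open>matrix\<close> applies since the weighted combination vanishes on the
    boundary along with \<open>u\<close> and \<open>w\<close>.\<close>
  then have A: "A \<alpha> (s n) (\<lambda>z. \<sigma> * w z + (1 - \<sigma>) * u z) x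
      = d n \<alpha> x * (\<sigma> * w x + (1 - \<sigma>) * u x) - (\<sigma> * ?S w + (1 - \<sigma>) * ?S u)"
    using assms x by (subst matrix) auto
  have "(w x - u x) / \<tau> + b = f x \<longleftrightarrow> w x - u x + \<tau> * b = \<tau> * f x" for b
    using tau by (auto simp: field_simps)
  then show "(w x - u x) / \<tau> + A \<alpha> (s n) (\<lambda>z. \<sigma> * w z + (1 - \<sigma>) * u z) x = f x
      \<longleftrightarrow> (1 + \<sigma> * \<tau> * d n \<alpha> x) * w x - \<sigma> * \<tau> * ?S w
        = (1 - (1 - \<sigma>) * \<tau> * d n \<alpha> x) * u x + (1 - \<sigma>) * \<tau> * ?S u + \<tau> * f x"
    unfolding A by (simp only:) (auto simp: algebra_simps)
qed

text \<open>The scheme prescribes boundary values for the new level of each half step only. The old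
  level is the new level of the preceding half step (for \<open>\<alpha> = 1\<close> that of the
  preceding time step), or the initial one.\<close>

lemma boundary_before_half_step:
  assumes "\<forall>x\<in>boundary_grid N h. y 0 x = (0 :: real)"
    and "\<forall>n\<in>time_steps \<tau> T. \<forall>\<alpha>\<in>{1, 2}. \<forall>x\<in>boundary_grid N h. y (2 * n + \<alpha>) x = 0"
    and "n \<in> time_steps \<tau> T" "\<alpha> \<in> {1, 2}"
  shows "\<forall>x\<in>boundary_grid N h. y (2 * n + (\<alpha> - 1)) x = 0"
proof (cases "\<alpha> = 1")
  case True
  show ?thesis
  proof (cases n)
    case 0
    with True assms(1) show ?thesis by simp
  next
    case (Suc m)
    then have "m \<in> time_steps \<tau> T" using time_steps_downward[OF assms(3)] tau by simp
    then have "\<forall>x\<in>boundary_grid N h. y (2 * m + 2) x = 0" using assms(2) by blast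
    then show ?thesis using True Suc by simp
  qed
next
  case False
  with assms show ?thesis by auto
qed

lemma lod_solution_iff:
  "lod_solution N h T \<tau> \<sigma> s A u0 \<phi> y \<longleftrightarrow>
    (\<forall>x\<in>boundary_grid N h. y 0 x = 0) \<and> (\<forall>x\<in>inner_grid N h. y 0 x = u0 x) \<and>
    (\<forall>n\<in>time_steps \<tau> T. \<forall>\<alpha>\<in>{1, 2}. (\<forall>x\<in>boundary_grid N h. y (2 * n + \<alpha>) x = 0) \<and>
      half_step n \<alpha> (source \<phi> n \<alpha>) (y (2 * n + (\<alpha> - 1))) (y (2 * n + \<alpha>)))"
  (is "_ = ?rhs")
proof (cases "(\<forall>x\<in>boundary_grid N h. y 0 x = 0) \<and>
    (\<forall>n\<in>time_steps \<tau> T. \<forall>\<alpha>\<in>{1, 2}. \<forall>x\<in>boundary_grid N h. y (2 * n + \<alpha>) x = 0)")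
  case True
  have iff: "(\<forall>x\<in>inner_grid N h. (y (2 * n + \<alpha>) x - y (2 * n + (\<alpha> - 1)) x) / \<tau>
      + A \<alpha> (s n) (\<lambda>z. \<sigma> * y (2 * n + \<alpha>) z + (1 - \<sigma>) * y (2 * n + (\<alpha> - 1)) z) x
        = source \<phi> n \<alpha> x)
    \<longleftrightarrow> half_step n \<alpha> (source \<phi> n \<alpha>) (y (2 * n + (\<alpha> - 1))) (y (2 * n + \<alpha>))"
    if "n \<in> time_steps \<tau> T" "\<alpha> \<in> {1, 2}" for n \<alpha>
    using that True boundary_before_half_step[of y n \<alpha>] by (intro half_step_iff) blast+
  show ?thesis
    unfolding lod_solution_def
    by (intro conj_cong refl ball_cong) (rule iff, assumption+)
next
  case False
  \<comment> \<open>Both sides contain these boundary conditions, so both are false.\<close>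
  then show ?thesis unfolding lod_solution_def by blast
qed

lemma solution_half_steps:
  assumes "lod_solution N h T \<tau> \<sigma> s A u0 \<phi> y" "n \<in> time_steps \<tau> T"
  shows "half_step n 1 (\<lambda>_. 0) (y (2 * n)) (y (2 * n + 1))"
    and "half_step n 2 (\<phi> n) (y (2 * n + 1)) (y (2 * n + 2))"
proof -
  have *: "half_step n \<alpha> (source \<phi> n \<alpha>) (y (2 * n + (\<alpha> - 1))) (y (2 * n + \<alpha>))" if "\<alpha> \<in> {1, 2}" for \<alpha>
    using assms that unfolding lod_solution_iff by blast
  show "half_step n 1 (\<lambda>_. 0) (y (2 * n)) (y (2 * n + 1))"
    using *[of 1] by simp
  show "half_step n 2 (\<phi> n) (y (2 * n + 1)) (y (2 * n + 2))"
    using *[of 2] by simp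
qed

section \<open>Existence, uniqueness, monotonicity and the a priori estimate\<close>

lemma solution_exists: "\<exists>y. lod_solution N h T \<tau> \<sigma> s A u0 \<phi> y"
proof -
  let ?X = "inner_grid N h"
  \<comment> \<open>Recursion over half steps: \<open>m\<close> encodes \<open>n = m div 2\<close>
    and \<open>\<alpha> = m mod 2 + 1\<close>. Beyond the time interval no equation is imposed and 0
    is a valid choice, so the recursion is total.\<close>
  define good where "good m u w \<longleftrightarrow> (m div 2 \<in> time_steps \<tau> T \<longrightarrow>
      half_step (m div 2) (m mod 2 + 1) (source \<phi> (m div 2) (m mod 2 + 1)) u w) \<and>
    (\<forall>x. x \<notin> ?X \<longrightarrow> w x = 0)" for m u w
  have "\<exists>w. good m u w" for m u
  proof (cases "m div 2 \<in> time_steps \<tau> T")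
    case True
    have "m mod 2 + 1 \<in> {1, 2}" by auto
    from stable_operator.step_exists[OF stable[OF True this] weights(1)]
    show ?thesis unfolding good_def by blast
  next
    case False
    then have "good m u (\<lambda>_. 0)" unfolding good_def by simp
    then show ?thesis by blast
  qed
  then obtain sol where sol: "\<And>m u. good m u (sol m u)" by metis
  define y where "y = rec_nat (\<lambda>x. if x \<in> ?X then u0 x else 0) sol"
  have y_simps: "y 0 = (\<lambda>x. if x \<in> ?X then u0 x else 0)" "\<And>m. y (Suc m) = sol m (y m)"
    by (simp_all add: y_def)
  have outside: "y m x = 0" if "x \<notin> ?X" for m x
  proof (cases m)
    case (Suc m')
    have "\<forall>x. x \<notin> ?X \<longrightarrow> sol m' (y m') x = 0"
      using sol[of m' "y m'"] unfolding good_def by (rule conjunct2)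
    with that show ?thesis unfolding Suc y_simps by blast
  qed (use that in \<open>simp add: y_simps\<close>)
  have "half_step n \<alpha> (source \<phi> n \<alpha>) (y (2 * n + (\<alpha> - 1))) (y (2 * n + \<alpha>))"
    if "n \<in> time_steps \<tau> T" "\<alpha> \<in> {1, 2}" for n \<alpha>
  proof -
    have m: "(2 * n + (\<alpha> - 1)) div 2 = n" "(2 * n + (\<alpha> - 1)) mod 2 + 1 = \<alpha>"
      "2 * n + \<alpha> = Suc (2 * n + (\<alpha> - 1))"
      using that(2) by auto
    show ?thesis
      using mp[OF conjunct1[OF sol[of "2 * n + (\<alpha> - 1)" "y (2 * n + (\<alpha> - 1))", unfolded good_def]]]
        that(1)
      unfolding m(1,2) m(3) y_simps by (rule meta_mp)
  qed
  then have "lod_solution N h T \<tau> \<sigma> s A u0 \<phi> y"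
    unfolding lod_solution_iff using outside by (auto simp: y_simps boundary_grid_def)
  then show ?thesis by blast
qed

lemma solution_unique:
  assumes "lod_solution N h T \<tau> \<sigma> s A u0 \<phi> y" "lod_solution N h T \<tau> \<sigma> s A u0 \<phi> y'"
    and "n \<in> time_steps \<tau> T" "\<alpha> \<in> {1, 2}" "x \<in> closed_grid N h"
  shows "y' (2 * n + \<alpha>) x = y (2 * n + \<alpha>) x"
proof -
  let ?eq = "\<lambda>m. \<forall>x\<in>inner_grid N h. y' m x = y m x"
  have step: "?eq (2 * n + 1) \<and> ?eq (2 * n + 2)" if "?eq (2 * n)" "n \<in> time_steps \<tau> T" for n
  proof -
    have first: "?eq (2 * n + 1)"
      using stable_operator.step_unique[OF stable[OF that(2), of 1] weights(1)
          solution_half_steps(1)[OF assms(2) that(2)] solution_half_steps(1)[OF assms(1) that(2)]]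
        that(1) by auto
    moreover have "?eq (2 * n + 2)"
      using stable_operator.step_unique[OF stable[OF that(2), of 2] weights(1)
          solution_half_steps(2)[OF assms(2) that(2)] solution_half_steps(2)[OF assms(1) that(2)]]
        first by auto
    ultimately show ?thesis by blast
  qed
  have "?eq (2 * n)" using assms(3)
  proof (induction n)
    case 0
    show ?case using assms(1,2) unfolding lod_solution_iff by simp
  next
    case (Suc n)
    have "n \<in> time_steps \<tau> T" using time_steps_downward[OF Suc.prems] tau by simp
    with step Suc.IH show ?case by simp
  qed
  with step[OF _ assms(3)] have "\<forall>x\<in>inner_grid N h. y' (2 * n + \<alpha>) x = y (2 * n + \<alpha>) x"
    using assms(4) by blast
  moreover have "y' (2 * n + \<alpha>) x = y (2 * n + \<alpha>) x" if "x \<in> boundary_grid N h"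
  proof -
    have "y (2 * n + \<alpha>) x = 0" "y' (2 * n + \<alpha>) x = 0"
      using assms(1-4) that unfolding lod_solution_iff by blast+
    then show ?thesis by simp
  qed
  ultimately show ?thesis using assms(5) unfolding closed_grid_eq by blast
qed

lemma well_posed: "lod_well_posed N h T \<tau> \<sigma> s A"
  unfolding lod_well_posed_def using solution_exists solution_unique by meson

lemma monotone: "lod_monotone N h T \<tau> \<sigma> s A"
  unfolding lod_monotone_def
proof (intro allI impI)
  fix u0 \<phi> y
  assume sol: "lod_solution N h T \<tau> \<sigma> s A u0 \<phi> y" and u0: "\<forall>x\<in>inner_grid N h. 0 \<le> u0 x"
    and \<phi>: "\<forall>n\<in>time_steps \<tau> T. \<forall>x\<in>inner_grid N h. 0 \<le> \<phi> n x"
  have step: "\<forall>x\<in>inner_grid N h. 0 \<le> y (2 * (n + 1)) x"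
    if n: "n \<in> time_steps \<tau> T" and y: "\<forall>x\<in>inner_grid N h. 0 \<le> y (2 * n) x" for n
  proof -
    have "\<forall>x\<in>inner_grid N h. 0 \<le> y (2 * n + 1) x"
      using stable_operator.step_nonneg[OF stable[OF n, of 1] weights
          step_size[OF n, of 1] solution_half_steps(1)[OF sol n]] y by simp
    then have "\<forall>x\<in>inner_grid N h. 0 \<le> y (2 * n + 2) x"
      using stable_operator.step_nonneg[OF stable[OF n, of 2] weights
          step_size[OF n, of 2] solution_half_steps(2)[OF sol n]] \<phi> n tau by simp
    then show ?thesis by simp
  qed
  show "\<forall>n\<in>time_steps \<tau> T. \<forall>x\<in>inner_grid N h. 0 \<le> y (2 * (n + 1)) x"
  proof
    fix n assume "n \<in> time_steps \<tau> T"
    then show "\<forall>x\<in>inner_grid N h. 0 \<le> y (2 * (n + 1)) x"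
    proof (induction n)
      case 0
      then show ?case using u0 sol unfolding lod_solution_iff by (intro step) auto
    next
      case (Suc n)
      then show ?case using time_steps_downward[OF Suc.prems, of n] tau by (intro step) auto
    qed
  qed
qed

lemma norm_bound:
  assumes sol: "lod_solution N h T \<tau> \<sigma> s A u0 \<phi> y" and "n \<in> time_steps \<tau> T"
  shows "nrm (y (2 * (n + 1))) \<le> nrm u0 + (\<Sum>j=0..n. \<tau> * nrm (\<phi> j))"
proof -
  have step: "nrm (y (2 * (n + 1))) \<le> nrm (y (2 * n)) + \<tau> * nrm (\<phi> n)"
    if n: "n \<in> time_steps \<tau> T" for n
  proof -
    \<comment> \<open>The first half step has no source, so it does not increase the norm; the whole
      contribution of \<open>\<phi> n\<close> enters in the second.\<close>
    have "nrm (\<lambda>_. 0) = 0"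
      using stable_operator.nrm_zero[OF stable[OF n, of 1]] by simp
    then have "nrm (y (2 * n + 1)) \<le> nrm (y (2 * n))"
      using stable_operator.step_norm_le[OF stable[OF n, of 1] weights
          step_size[OF n, of 1] solution_half_steps(1)[OF sol n]] by simp
    moreover have "nrm (y (2 * n + 2)) \<le> nrm (y (2 * n + 1)) + nrm (\<lambda>x. \<tau> * \<phi> n x)"
      using stable_operator.step_norm_le[OF stable[OF n, of 2] weights
          step_size[OF n, of 2] solution_half_steps(2)[OF sol n]] by simp
    ultimately show ?thesis using nrm_scale[of "\<phi> n"] by simp
  qed
  show ?thesis using assms(2)
  proof (induction n)
    case 0
    \<comment> \<open>\<open>y 0\<close> and \<open>u0\<close> are known to agree only at inner
      nodes, hence monotonicity of the norm instead of equality of functions.\<close>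
    have "nrm (y 0) \<le> nrm u0"
      using sol unfolding lod_solution_iff
      by (intro stable_operator.nrm_mono[OF stable[OF 0, of 1]]) auto
    with step[OF 0] show ?case by simp
  next
    case (Suc n)
    have "n \<in> time_steps \<tau> T" using time_steps_downward[OF Suc.prems] tau by simp
    with step[OF Suc.prems] Suc.IH show ?case by simp
  qed
qed

end

section \<open>The difference operators\<close>

text \<open>The factor \<open>c\<close> is real so that it covers both the neighbours
  (\<open>c = \<plusminus>1\<close>) and the midpoints (\<open>c = \<plusminus>1/2\<close>) at which
  \<open>k\<close> is sampled.\<close>

definition shift :: "(nat \<Rightarrow> real) \<Rightarrow> nat \<Rightarrow> real \<Rightarrow> real \<times> real \<Rightarrow> real \<times> real" where
  "shift h \<alpha> c x = (if \<alpha> = 1 then (fst x + c * h 1, snd x) else (fst x, snd x + c * h 2))"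

text \<open>
  For \<open>c = \<plusminus>1\<close>, the modulus of the coefficient of \<open>w (shift h \<alpha> c x)\<close> in case a and, as \<open>op_b\<close>
  is the transpose of \<open>op_a\<close>, that of \<open>w x\<close> in \<open>op_b\<close> at the node \<open>shift h \<alpha> c x\<close>.
\<close>

definition weight ::
  "(nat \<Rightarrow> real) \<Rightarrow> (real \<times> real \<Rightarrow> real) \<Rightarrow> (nat \<Rightarrow> real \<times> real \<Rightarrow> real \<Rightarrow> real)
    \<Rightarrow> nat \<Rightarrow> real \<Rightarrow> real \<Rightarrow> real \<times> real \<Rightarrow> real" where
  "weight h k v \<alpha> t c x =
    1 / (h \<alpha>)\<^sup>2 * k (shift h \<alpha> (c / 2) x) * exp (c * theta k v \<alpha> x t * h \<alpha>)"

text \<open>Transposition keeps the diagonal, so this is the diagonal of \<open>op_a\<close> and of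
  \<open>op_b\<close>.\<close>

definition diagonal ::
  "(nat \<Rightarrow> real) \<Rightarrow> (real \<times> real \<Rightarrow> real) \<Rightarrow> (nat \<Rightarrow> real \<times> real \<Rightarrow> real \<Rightarrow> real)
    \<Rightarrow> nat \<Rightarrow> real \<Rightarrow> real \<times> real \<Rightarrow> real" where
  "diagonal h k v \<alpha> t x = weight h k v \<alpha> t 1 x + weight h k v \<alpha> t (- 1) x"

definition coupling ::
  "(nat \<Rightarrow> real) \<Rightarrow> (real \<times> real \<Rightarrow> real) \<Rightarrow> (nat \<Rightarrow> real \<times> real \<Rightarrow> real \<Rightarrow> real)
    \<Rightarrow> nat \<Rightarrow> real \<Rightarrow> real \<times> real \<Rightarrow> real \<times> real \<Rightarrow> real" where
  "coupling h k v \<alpha> t x z =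
    (if z = shift h \<alpha> 1 x then weight h k v \<alpha> t 1 x else 0)
    + (if z = shift h \<alpha> (- 1) x then weight h k v \<alpha> t (- 1) x else 0)"

lemma shift_shift: "shift h \<alpha> a (shift h \<alpha> b x) = shift h \<alpha> (a + b) x"
  by (simp add: shift_def algebra_simps)

lemma shift_zero [simp]: "shift h \<alpha> 0 x = x"
  by (simp add: shift_def)

lemma shift_eq_iff: "x = shift h \<alpha> c z \<longleftrightarrow> z = shift h \<alpha> (- c) x"
  by (auto simp: shift_shift)

lemma shift_in_closed_grid:
  assumes "x \<in> inner_grid N h" "c \<in> {1, - 1}"
  shows "shift h \<alpha> c x \<in> closed_grid N h"
proof -
  obtain i j where ij: "x = (real i * h 1, real j * h 2)" "i \<in> {1..N 1 - 1}" "j \<in> {1..N 2 - 1}"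
    using assms(1) unfolding inner_grid_def by blast
  \<comment> \<open>Subtraction on naturals is exact here: inner indices are at least 1.\<close>
  define up :: "nat \<Rightarrow> nat" where "up m = (if c = 1 then m + 1 else m - 1)" for m
  have up: "real m + c = real (up m)" "up m \<in> {0..M}" if "m \<in> {1..M - 1}" for m M
    using assms(2) that by (auto simp: up_def of_nat_diff)
  have "real i * h 1 + c * h 1 = real (up i) * h 1" "real j * h 2 + c * h 2 = real (up j) * h 2"
    using up(1)[OF ij(2)] up(1)[OF ij(3)] by (simp_all add: distrib_right[symmetric])
  moreover have "i \<in> {0..N 1}" "j \<in> {0..N 2}" using ij by auto
  ultimately show ?thesis
    using up(2)[OF ij(2)] up(2)[OF ij(3)] ij(1) unfolding closed_grid_def shift_def by auto
qed

lemma op_a_eq: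
  assumes "\<alpha> \<in> {1, 2}"
  shows "op_a h k v \<alpha> t w x = diagonal h k v \<alpha> t x * w x
    - (weight h k v \<alpha> t 1 x * w (shift h \<alpha> 1 x)
      + weight h k v \<alpha> t (- 1) x * w (shift h \<alpha> (- 1) x))"
  using assms
  by (cases x) (auto simp: op_a_def diagonal_def weight_def shift_def algebra_simps
      add_divide_distrib diff_divide_distrib)

text \<open>Half a step back from a neighbour of \<open>x\<close> is the midpoint next to
  \<open>x\<close>, so the off-diagonal coefficients are the weights of the neighbours pointing
  towards \<open>x\<close>.\<close>

lemma op_b_eq:
  assumes "\<alpha> \<in> {1, 2}"
  shows "op_b h k v \<alpha> t w x = diagonal h k v \<alpha> t x * w x
    - (weight h k v \<alpha> t (- 1) (shift h \<alpha> 1 x) * w (shift h \<alpha> 1 x)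
      + weight h k v \<alpha> t 1 (shift h \<alpha> (- 1) x) * w (shift h \<alpha> (- 1) x))"
  using assms unfolding weight_def diagonal_def shift_shift
  by (cases x) (auto simp: op_b_def shift_def algebra_simps)

text \<open>The zero boundary condition enters here: a boundary node \<open>p\<close> is missing
  from the sum, but then \<open>w p = 0\<close>.\<close>

lemma sum_single_node:
  assumes "\<forall>x\<in>boundary_grid N h. w x = (0 :: real)" "p \<in> closed_grid N h"
  shows "(\<Sum>z\<in>inner_grid N h. (if z = p then a else 0) * w z) = a * w p"
proof -
  have "(\<Sum>z\<in>inner_grid N h. (if z = p then a else 0) * w z)
      = (\<Sum>z\<in>inner_grid N h. if z = p then a * w z else 0)"
    by (rule sum.cong) auto
  also have "\<dots> = (if p \<in> inner_grid N h then a * w p else 0)"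
    using finite_inner_grid by (rule sum.delta)
  finally show ?thesis using assms by (auto simp: closed_grid_eq)
qed

lemma sum_coupling:
  assumes "\<forall>x\<in>boundary_grid N h. w x = 0" "x \<in> inner_grid N h"
  shows "(\<Sum>z\<in>inner_grid N h. coupling h k v \<alpha> t x z * w z)
    = weight h k v \<alpha> t 1 x * w (shift h \<alpha> 1 x)
      + weight h k v \<alpha> t (- 1) x * w (shift h \<alpha> (- 1) x)"
  using shift_in_closed_grid[OF assms(2), of 1] shift_in_closed_grid[OF assms(2), of "- 1"]
  by (simp add: coupling_def distrib_right sum.distrib sum_single_node[OF assms(1)])

lemma sum_coupling_transpose:
  assumes "\<forall>x\<in>boundary_grid N h. w x = 0" "x \<in> inner_grid N h"
  shows "(\<Sum>z\<in>inner_grid N h. coupling h k v \<alpha> t z x * w z)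
    = weight h k v \<alpha> t (- 1) (shift h \<alpha> 1 x) * w (shift h \<alpha> 1 x)
      + weight h k v \<alpha> t 1 (shift h \<alpha> (- 1) x) * w (shift h \<alpha> (- 1) x)"
proof -
  \<comment> \<open>Inverting the neighbour relation: \<open>x\<close> is the upper neighbour of
    \<open>z\<close> iff \<open>z\<close> is the lower neighbour of \<open>x\<close>, so the two
    weights change places.\<close>
  have "coupling h k v \<alpha> t z x
      = (if z = shift h \<alpha> 1 x then weight h k v \<alpha> t (- 1) (shift h \<alpha> 1 x) else 0)
      + (if z = shift h \<alpha> (- 1) x then weight h k v \<alpha> t 1 (shift h \<alpha> (- 1) x) else 0)" for z
    unfolding coupling_def shift_eq_iff[of x] by simp
  then show ?thesis
    using shift_in_closed_grid[OF assms(2), of 1] shift_in_closed_grid[OF assms(2), of "- 1"]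
    by (simp add: distrib_right sum.distrib sum_single_node[OF assms(1)])
qed

lemma op_a_matrix:
  assumes "\<alpha> \<in> {1, 2}" "\<forall>x\<in>boundary_grid N h. w x = 0" "x \<in> inner_grid N h"
  shows "op_a h k v \<alpha> t w x
    = diagonal h k v \<alpha> t x * w x - (\<Sum>z\<in>inner_grid N h. coupling h k v \<alpha> t x z * w z)"
  unfolding op_a_eq[OF assms(1)] sum_coupling[OF assms(2,3)] ..

lemma op_b_matrix:
  assumes "\<alpha> \<in> {1, 2}" "\<forall>x\<in>boundary_grid N h. w x = 0" "x \<in> inner_grid N h"
  shows "op_b h k v \<alpha> t w x
    = diagonal h k v \<alpha> t x * w x - (\<Sum>z\<in>inner_grid N h. coupling h k v \<alpha> t z x * w z)"
  unfolding op_b_eq[OF assms(1)] sum_coupling_transpose[OF assms(2,3)] ..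

section \<open>Sign and size of the coefficients\<close>

lemma weight_pos:
  assumes grid: "\<forall>\<alpha>\<in>{1, 2}. 0 < h \<alpha> \<and> real (N \<alpha>) * h \<alpha> = l \<alpha>"
    and k_pos: "\<forall>x\<in>{0..l 1} \<times> {0..l 2}. 0 < k x"
    and "\<alpha> \<in> {1, 2}" "x \<in> inner_grid N h" "c \<in> {1, - 1}"
  shows "0 < weight h k v \<alpha> t c x"
proof -
  obtain i j where ij: "x = (real i * h 1, real j * h 2)" "i \<in> {1..N 1 - 1}" "j \<in> {1..N 2 - 1}"
    using assms(4) unfolding inner_grid_def by blast
  have h: "0 < h 1" "0 < h 2" "real (N 1) * h 1 = l 1" "real (N 2) * h 2 = l 2"
    using grid by auto
  \<comment> \<open>\<open>e = c / 2\<close> is for the shifted coordinate and \<open>e = 0\<close>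
    for the other one. Inner indices leave room for half a step, so midpoints stay in the rectangle
    where \<open>k\<close> is positive.\<close>
  have within: "real m * a + e * a \<in> {0..real M * a}"
    if "m \<in> {1..M - 1}" "0 < a" "e \<in> {0, c / 2}" for m M :: nat and a e :: real
  proof -
    have "0 \<le> real m + e" "real m + e \<le> real M"
      using that assms(5) by (auto simp: field_simps)
    then have "0 \<le> (real m + e) * a" "(real m + e) * a \<le> real M * a"
      using that(2) by auto
    then show ?thesis by (simp add: distrib_right)
  qed
  have "shift h \<alpha> (c / 2) x \<in> {0..l 1} \<times> {0..l 2}"
    using within[OF ij(2) h(1), of 0] within[OF ij(3) h(2), of 0]
      within[OF ij(2) h(1), of "c / 2"] within[OF ij(3) h(2), of "c / 2"]
    unfolding ij(1) shift_def h(3,4) by auto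
  then have "0 < k (shift h \<alpha> (c / 2) x)" by (rule bspec[OF k_pos])
  then show ?thesis
    using grid assms(3) unfolding weight_def by (intro mult_pos_pos) auto
qed

lemma diagonal_le_gam:
  assumes "\<alpha> \<in> {1, 2}" "x \<in> inner_grid N h"
  shows "diagonal h k v \<alpha> t x \<le> gam N h k v t"
proof -
  have "max (diagonal h k v 1 t x) (diagonal h k v 2 t x) \<le> gam N h k v t"
    unfolding gam_def
    by (rule Max_ge)
      (use finite_inner_grid assms(2) in \<open>auto simp: diagonal_def weight_def shift_def
        intro!: image_eqI[of _ _ x] split: prod.split\<close>)
  with assms(1) show ?thesis by auto
qed

text \<open>A neighbour on the boundary drops out of the sum, and its nonnegative weight is the
  possible gap in the inequality.\<close>

lemma row_sum_coupling_le:
  assumes "0 \<le> weight h k v \<alpha> t 1 x" "0 \<le> weight h k v \<alpha> t (- 1) x"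
  shows "(\<Sum>z\<in>inner_grid N h. coupling h k v \<alpha> t x z) \<le> diagonal h k v \<alpha> t x"
  using assms finite_inner_grid
  by (simp add: coupling_def sum.distrib sum.delta diagonal_def)

theorem theorem29:
  fixes N :: "nat \<Rightarrow> nat" and h l :: "nat \<Rightarrow> real"
    and k :: "real \<times> real \<Rightarrow> real"
    and v :: "nat \<Rightarrow> real \<times> real \<Rightarrow> real \<Rightarrow> real"
    and \<kappa>1 T \<tau> \<sigma> :: real and s :: "nat \<Rightarrow> real"
  assumes grid: "\<forall>\<alpha>\<in>{1, 2}. 2 \<le> N \<alpha> \<and> 0 < h \<alpha> \<and> real (N \<alpha>) * h \<alpha> = l \<alpha>"
    and kappa: "0 < \<kappa>1"
    and k_ge: "\<forall>x\<in>{0..l 1} \<times> {0..l 2}. \<kappa>1 \<le> k x"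
    and tau: "0 < \<tau>"
    and times: "\<forall>n\<in>time_steps \<tau> T. real n * \<tau> \<le> s n \<and> s n \<le> real (n + 1) * \<tau>"
    and sigma: "0 \<le> \<sigma>" "\<sigma> \<le> 1"
    and constraint: "\<sigma> < 1 \<longrightarrow>
      (\<forall>n\<in>time_steps \<tau> T. \<tau> \<le> 1 / ((1 - \<sigma>) * gam N h k v (s n)))"
  shows "(lod_well_posed N h T \<tau> \<sigma> s (op_a h k v) \<and>
          lod_monotone N h T \<tau> \<sigma> s (op_a h k v) \<and>
          (\<forall>u0 \<phi> y. lod_solution N h T \<tau> \<sigma> s (op_a h k v) u0 \<phi> y \<longrightarrow>
            (\<forall>n\<in>time_steps \<tau> T.
              norm_Linf N h (y (2 * (n + 1)))
                \<le> norm_Linf N h u0 + (\<Sum>j=0..n. \<tau> * norm_Linf N h (\<phi> j))))) \<and>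
         (lod_well_posed N h T \<tau> \<sigma> s (op_b h k v) \<and>
          lod_monotone N h T \<tau> \<sigma> s (op_b h k v) \<and>
          (\<forall>u0 \<phi> y. lod_solution N h T \<tau> \<sigma> s (op_b h k v) u0 \<phi> y \<longrightarrow>
            (\<forall>n\<in>time_steps \<tau> T.
              norm_L1 N h (y (2 * (n + 1)))
                \<le> norm_L1 N h u0 + (\<Sum>j=0..n. \<tau> * norm_L1 N h (\<phi> j)))))"
proof -
  have k_pos: "\<forall>x\<in>{0..l 1} \<times> {0..l 2}. 0 < k x"
    using k_ge kappa by (metis less_le_trans)
  have weight: "0 < weight h k v \<alpha> t c x"
    if "\<alpha> \<in> {1, 2}" "x \<in> inner_grid N h" "c \<in> {1, - 1}" for \<alpha> t x c
    using grid k_pos that by (intro weight_pos[of h N l]) auto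
  have coupling: "0 \<le> coupling h k v \<alpha> t x z"
    if "\<alpha> \<in> {1, 2}" "x \<in> inner_grid N h" for \<alpha> t x z
    using weight[OF that, of 1 t] weight[OF that, of "- 1" t] by (simp add: coupling_def)
  have rows: "(\<Sum>z\<in>inner_grid N h. coupling h k v \<alpha> t x z) \<le> diagonal h k v \<alpha> t x"
    if "\<alpha> \<in> {1, 2}" "x \<in> inner_grid N h" for \<alpha> t x
    using weight[OF that, of 1 t] weight[OF that, of "- 1" t] by (intro row_sum_coupling_le) auto
  have step_size: "(1 - \<sigma>) * \<tau> * diagonal h k v \<alpha> (s n) x \<le> 1"
    if "n \<in> time_steps \<tau> T" "\<alpha> \<in> {1, 2}" "x \<in> inner_grid N h" for n \<alpha> x
  proof (cases "\<sigma> = 1")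
    case False
    then have \<sigma>: "\<sigma> < 1" using sigma by simp
    have le: "diagonal h k v \<alpha> (s n) x \<le> gam N h k v (s n)"
      using that by (intro diagonal_le_gam)
    \<comment> \<open>This makes \<open>gam\<close> positive, so that the denominator in the
      constraint can be cleared.\<close>
    have "0 < diagonal h k v \<alpha> (s n) x"
      using weight[OF that(2,3), of 1 "s n"] weight[OF that(2,3), of "- 1" "s n"]
      by (simp add: diagonal_def)
    with le \<sigma> have "0 < (1 - \<sigma>) * gam N h k v (s n)" by simp
    moreover have "\<tau> \<le> 1 / ((1 - \<sigma>) * gam N h k v (s n))"
      using constraint \<sigma> that(1) by blast
    ultimately have "(1 - \<sigma>) * \<tau> * gam N h k v (s n) \<le> 1"
      by (simp add: pos_le_divide_eq mult_ac)
    moreover have "(1 - \<sigma>) * \<tau> * diagonal h k v \<alpha> (s n) x \<le> (1 - \<sigma>) * \<tau> * gam N h k v (s n)"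
      using le \<sigma> tau by (intro mult_left_mono) auto
    ultimately show ?thesis by linarith
  qed simp
  have ne: "inner_grid N h \<noteq> {}"
    using grid by (auto simp: inner_grid_def)
  interpret a: lod_scheme N h T \<tau> \<sigma> s "op_a h k v" "norm_Linf N h"
    "\<lambda>n \<alpha>. diagonal h k v \<alpha> (s n)" "\<lambda>n \<alpha>. coupling h k v \<alpha> (s n)"
  proof (rule lod_scheme.intro)
    show "norm_Linf N h (\<lambda>x. \<tau> * u x) \<le> \<tau> * norm_Linf N h u" for u
      unfolding norm_Linf_def using finite_inner_grid[of N h] ne tau by (simp add: abs_mult)
    show "stable_operator (inner_grid N h) (norm_Linf N h)
        (diagonal h k v \<alpha> (s n)) (coupling h k v \<alpha> (s n))" if "\<alpha> \<in> {1, 2}" for n \<alpha>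
      unfolding norm_Linf_def using finite_inner_grid ne coupling[OF that] rows[OF that]
      by (intro stable_operator_Max) auto
  qed (rule tau sigma step_size op_a_matrix; assumption)+
  \<comment> \<open>With the arguments of \<open>coupling\<close> exchanged, the row bound
    \<open>rows\<close> is the column bound required for the sum norm; \<open>step_size\<close> is
    shared.\<close>
  interpret b: lod_scheme N h T \<tau> \<sigma> s "op_b h k v" "norm_L1 N h"
    "\<lambda>n \<alpha>. diagonal h k v \<alpha> (s n)" "\<lambda>n \<alpha> x z. coupling h k v \<alpha> (s n) z x"
  proof (rule lod_scheme.intro)
    show "norm_L1 N h (\<lambda>x. \<tau> * u x) \<le> \<tau> * norm_L1 N h u" for u
      unfolding norm_L1_def using tau by (simp add: abs_mult sum_distrib_left)
    show "stable_operator (inner_grid N h) (norm_L1 N h)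
        (diagonal h k v \<alpha> (s n)) (\<lambda>x z. coupling h k v \<alpha> (s n) z x)" if "\<alpha> \<in> {1, 2}" for n \<alpha>
      unfolding norm_L1_def using finite_inner_grid coupling[OF that] rows[OF that]
      by (intro stable_operator_sum) auto
  qed (rule tau sigma step_size op_b_matrix; assumption)+
  show ?thesis
    by (intro conjI allI impI ballI a.well_posed a.monotone a.norm_bound
        b.well_posed b.monotone b.norm_bound)
qed

end
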